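(* Consider majority processes, and separately minority processes, under the basic switching rule, where the initial coloring is uniform random (each node independently white or black with probability $\frac12$). There exists a class of graphs (containing graphs with $n$ nodes for arbitrarily large $n$) such that, with high probability over the initial coloring, the stabilization time is $\Omega(n^2)$; that is, w.h.p. there exists a valid sequence of $\Omega(n^2)$ switching steps starting from the initial coloring.
   Context: Graphs are simple, unweighted and undirected with $n$ nodes; $N(v)$ is the neighborhood of node $v$ and $d_v=|N(v)|$. A coloring assigns each node white or black. For a coloring, the conflicting neighbors $N_c(v)$ of $v$ are: in a majority process, the neighbors with color different from $v$; in a minority process, the neighbors with the same color as $v$. Under the basic switching rule, $v$ is switchable if $|N_c(v)|>\frac12 d_v$. The process is sequential: in each step exactly one switchable node (chosen by an adversary maximizing the number of steps) changes to the opposite color. A coloring is stable if no node is switchable; the stabilization time is the number of steps until a stable coloring is reached, under the adversarial (worst-case) choice of switching order. An event holds with high probability if it holds with probability at least $1-O(n^{-c})$ for some constant $c>0$. *)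

theory Defs
  imports
    "HOL-Probability.Probability"
    "Graph_Theory.Pair_Digraph"
begin

text \<open>A simple undirected graph is a \<^locale>\<open>pair_graph\<close>: a finite, loop-free digraph whose arc
  relation is symmetric, an undirected edge being the two opposite arcs.\<close>

type_synonym 'a sgraph = "'a pair_pre_digraph"

definition num_nodes :: "'a sgraph \<Rightarrow> nat" where
  "num_nodes G = card (pverts G)"

definition neighborhood :: "'a sgraph \<Rightarrow> 'a \<Rightarrow> 'a set" where
  "neighborhood G v = {u. (v, u) \<in> parcs G}"

datatype color = White | Black

fun opposite :: "color \<Rightarrow> color" where
  "opposite White = Black"
| "opposite Black = White"

datatype process = Majority | Minority

fun conflicting :: "process \<Rightarrow> color \<Rightarrow> color \<Rightarrow> bool" where
  "conflicting Majority a b \<longleftrightarrow> a \<noteq> b"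
| "conflicting Minority a b \<longleftrightarrow> a = b"

definition conflicting_neighbors ::
  "process \<Rightarrow> 'a sgraph \<Rightarrow> ('a \<Rightarrow> color) \<Rightarrow> 'a \<Rightarrow> 'a set" where
  "conflicting_neighbors p G col v = {u \<in> neighborhood G v. conflicting p (col v) (col u)}"

definition switchable :: "process \<Rightarrow> 'a sgraph \<Rightarrow> ('a \<Rightarrow> color) \<Rightarrow> 'a \<Rightarrow> bool" where
  "switchable p G col v \<longleftrightarrow>
     real (card (conflicting_neighbors p G col v)) > 1 / 2 * real (card (neighborhood G v))"

definition switching_step ::
  "process \<Rightarrow> 'a sgraph \<Rightarrow> ('a \<Rightarrow> color) \<Rightarrow> ('a \<Rightarrow> color) \<Rightarrow> bool" where
  "switching_step p G col col' \<longleftrightarrow>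
     (\<exists>v \<in> pverts G. switchable p G col v \<and> col' = col(v := opposite (col v)))"

definition stable :: "process \<Rightarrow> 'a sgraph \<Rightarrow> ('a \<Rightarrow> color) \<Rightarrow> bool" where
  "stable p G col \<longleftrightarrow> (\<forall>v \<in> pverts G. \<not> switchable p G col v)"

text \<open>The adversary picks the switching order, so the stabilization time is the supremum of the
  number of steps over all runs that end in a stable coloring. It is taken in \<^typ>\<open>enat\<close>, where
  the supremum needs no side condition on the set of run lengths.\<close>

definition stabilization_time :: "process \<Rightarrow> 'a sgraph \<Rightarrow> ('a \<Rightarrow> color) \<Rightarrow> enat" where
  "stabilization_time p G col =
     Sup {enat k | k. \<exists>col'. (switching_step p G ^^ k) col col' \<and> stable p G col'}"

text \<open>Colorings are total functions; outside the node set, \<^const>\<open>Pi_pmf\<close> gives them the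
  fixed value \<^const>\<open>White\<close>, which no definition above depends on.\<close>

definition random_coloring :: "'a sgraph \<Rightarrow> ('a \<Rightarrow> color) pmf" where
  "random_coloring G = Pi_pmf (pverts G) White (\<lambda>_. pmf_of_set {White, Black})"

definition whp :: "'a sgraph set \<Rightarrow> ('a sgraph \<Rightarrow> ('a \<Rightarrow> color) \<Rightarrow> bool) \<Rightarrow> bool" where
  "whp \<G> E \<longleftrightarrow> (\<exists>c > 0. \<exists>C :: real. \<exists>n\<^sub>0. \<forall>G \<in> \<G>. num_nodes G \<ge> n\<^sub>0 \<longrightarrow>
     measure_pmf.prob (random_coloring G) {col. E G col} \<ge> 1 - C * real (num_nodes G) powr (- c))"

end

theory Submission
  imports Defs
begin

text \<open>
  The graph is a blow-up of a small bipartite graph of cells, so flipping the colors on one side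
  turns a minority process into a majority process and preserves the uniform distribution. For each
  color \<open>g\<close> there are \<open>8 q\<close> independent chains \<open>Inn g j\<close> -- \<open>Mid g j\<close> -- \<open>Out g j\<close>. A chain can be driven
  to \<open>g\<close> unless \<open>Mid g j\<close> and \<open>Out g j \<union> Inn g j\<close> both start with the wrong majority. As both sets
  have odd size, this has probability \<open>1/4\<close>: the choice of the switching order creates a bias towards
  either color. By Hoeffding's inequality, at least \<open>5 q\<close> chains per color succeed with high
  probability, which lets every node of \<open>Ctrl g\<close> switch to \<open>g\<close> at any later time, whatever the
  colors of \<open>Work\<close> are. The neighbors of a node of \<open>Work\<close> are the nodes of
  \<open>Ctrl Black \<union> Ctrl White\<close>, an odd number; turning alternately one node of \<open>Ctrl Black\<close> black and one node of
  \<open>Ctrl White\<close> white moves the imbalance between \<open>-1\<close> and \<open>1\<close>, and each time all \<open>q\<^sup>3\<close> workers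
  follow. This can be repeated \<open>\<Omega>(q\<^sup>3)\<close> times in a graph with \<open>\<Theta>(q\<^sup>3)\<close> nodes.
\<close>

section \<open>Imbalance and majority dynamics\<close>

fun spin :: "color \<Rightarrow> int" where
  "spin Black = 1"
| "spin White = -1"

text \<open>On a finite set, black nodes minus white nodes. Multiplied by \<open>spin g\<close> it
  is positive exactly when \<open>g\<close> has a strict majority in \<open>X\<close>, so one
  statement serves both colors.\<close>

definition imbalance :: "('a \<Rightarrow> color) \<Rightarrow> 'a set \<Rightarrow> int" where
  "imbalance col X = (\<Sum>v\<in>X. spin (col v))"

definition recolor :: "'a set \<Rightarrow> color \<Rightarrow> ('a \<Rightarrow> color) \<Rightarrow> 'a \<Rightarrow> color" where
  "recolor X g col = (\<lambda>v. if v \<in> X then g else col v)"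

lemma UNIV_color: "UNIV = {White, Black}"
proof -
  have "x = White \<or> x = Black" for x by (cases x) auto
  then show ?thesis by auto
qed

instance color :: finite
  by standard (simp add: UNIV_color)

lemma opposite_opposite [simp]: "opposite (opposite c) = c"
  by (cases c) auto

lemma spin_opposite [simp]: "spin (opposite c) = - spin c"
  by (cases c) auto

lemma spin_mult_self [simp]: "spin c * spin c = 1"
  by (cases c) auto

lemma abs_spin [simp]: "\<bar>spin c\<bar> = 1"
  by (cases c) auto

lemma spin_mult_le_1: "spin c * spin d \<le> 1"
  by (cases c; cases d) auto

lemma spin_mult_eq: "spin c * spin d = 1 - 2 * of_bool (d \<noteq> c)"
  by (cases c; cases d) auto

lemma neq_color_iff: "c \<noteq> d \<longleftrightarrow> c = opposite d"
  by (cases c; cases d) auto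

lemma imbalance_Un:
  "finite X \<Longrightarrow> finite Y \<Longrightarrow> X \<inter> Y = {} \<Longrightarrow> imbalance col (X \<union> Y) = imbalance col X + imbalance col Y"
  unfolding imbalance_def by (rule sum.union_disjoint)

lemma abs_imbalance_le: "\<bar>imbalance col X\<bar> \<le> int (card X)"
  unfolding imbalance_def using sum_abs[of "\<lambda>v. spin (col v)" X] by simp

lemma imbalance_cong: "(\<And>v. v \<in> X \<Longrightarrow> col v = col' v) \<Longrightarrow> imbalance col X = imbalance col' X"
  unfolding imbalance_def by (intro sum.cong) auto

lemma imbalance_const:
  assumes "\<And>v. v \<in> X \<Longrightarrow> col v = g"
  shows "imbalance col X = spin g * int (card X)"
proof -
  have "imbalance col X = (\<Sum>v\<in>X. spin g)"
    unfolding imbalance_def using assms by (intro sum.cong) auto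
  then show ?thesis by simp
qed

text \<open>Each node of color \<open>g\<close> contributes 1 and every other node -1. In particular
  an imbalance has the parity of \<open>card X\<close>.\<close>

lemma imbalance_eq_card:
  assumes "finite X"
  shows "spin g * imbalance col X = int (card X) - 2 * int (card {v \<in> X. col v \<noteq> g})"
proof -
  have "spin g * imbalance col X = (\<Sum>v\<in>X. 1 - 2 * of_bool (col v \<noteq> g))"
    unfolding imbalance_def sum_distrib_left
    by (simp add: spin_mult_eq)
  also have "\<dots> = int (card X) - 2 * (\<Sum>v\<in>X. of_bool (col v \<noteq> g))"
    by (simp add: sum_subtractf flip: sum_distrib_left)
  also have "(\<Sum>v\<in>X. of_bool (col v \<noteq> g)) = int (card {v \<in> X. col v \<noteq> g})"
    using assms by (simp add: sum.If_cases of_bool_def Int_def)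
  finally show ?thesis .
qed

lemma imbalance_recolor_disjoint: "X \<inter> Y = {} \<Longrightarrow> imbalance (recolor X g col) Y = imbalance col Y"
  by (intro imbalance_cong) (auto simp: recolor_def)

lemma imbalance_recolor_superset:
  "Y \<subseteq> X \<Longrightarrow> imbalance (recolor X g col) Y = spin g * int (card Y)"
  by (intro imbalance_const) (auto simp: recolor_def)

lemma imbalance_recolor_subset:
  assumes "finite Y" "X \<subseteq> Y" "\<And>v. v \<in> X \<Longrightarrow> col v \<noteq> g"
  shows "imbalance (recolor X g col) Y = imbalance col Y + 2 * spin g * int (card X)"
proof -
  have *: "imbalance c Y = imbalance c X + imbalance c (Y - X)" for c
    using imbalance_Un[of X "Y - X" c] assms finite_subset[of X Y] by (simp add: Un_absorb1)
  have "imbalance col X = spin (opposite g) * int (card X)"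
    using assms(3) by (intro imbalance_const) (simp add: neq_color_iff)
  then show ?thesis
    unfolding *[of col] *[of "recolor X g col"]
    by (simp add: imbalance_recolor_disjoint imbalance_recolor_superset)
qed

lemma spin_mult_imbalance_recolor_ge:
  "spin g * imbalance (recolor X g col) Y \<ge> spin g * imbalance col Y"
  unfolding imbalance_def sum_distrib_left recolor_def
  by (intro sum_mono) (simp add: spin_mult_le_1)

lemma finite_neighborhood: "pair_graph G \<Longrightarrow> finite (neighborhood G v)"
proof -
  assume "pair_graph G"
  then interpret pair_graph G .
  have "neighborhood G v \<subseteq> pverts G"
    using arc_snd_in_verts by (force simp: neighborhood_def)
  then show ?thesis using finite_subset pair_finite_verts by blast
qed

lemma switchable_Majority_iff:
  assumes "pair_graph G"
  shows "switchable Majority G col v \<longleftrightarrow> spin (col v) * imbalance col (neighborhood G v) < 0"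
proof -
  let ?N = "neighborhood G v"
  have "{u \<in> ?N. col u \<noteq> col v} = conflicting_neighbors Majority G col v"
    by (auto simp: conflicting_neighbors_def)
  then have "spin (col v) * imbalance col ?N =
      int (card ?N) - 2 * int (card (conflicting_neighbors Majority G col v))"
    using imbalance_eq_card[OF finite_neighborhood[OF assms], of "col v" col v] by simp
  then show ?thesis
    unfolding switchable_def by linarith
qed

text \<open>Switching some nodes to \<open>g\<close> only helps the other nodes of \<open>X\<close> to do so, hence the order is
  irrelevant and \<open>X\<close> need not be independent.\<close>

lemma recolor_run:
  assumes G: "pair_graph G" and "finite X" "X \<subseteq> pverts G"
    and "\<forall>v\<in>X. spin g * imbalance col (neighborhood G v) > 0"
  shows "(switching_step Majority G ^^ card {v \<in> X. col v \<noteq> g}) col (recolor X g col)"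
  using assms(2-4)
proof (induction X rule: finite_induct)
  case empty
  then show ?case by (simp add: recolor_def)
next
  case (insert x X)
  define c where "c = recolor X g col"
  have IH: "(switching_step Majority G ^^ card {v \<in> X. col v \<noteq> g}) col c"
    unfolding c_def using insert by auto
  have cx: "c x = col x" using insert by (simp add: c_def recolor_def)
  show ?case
  proof (cases "col x = g")
    case True
    then have "recolor (insert x X) g col = c" "{v \<in> insert x X. col v \<noteq> g} = {v \<in> X. col v \<noteq> g}"
      by (auto simp: c_def recolor_def)
    then show ?thesis using IH by simp
  next
    case False
    have "spin g * imbalance c (neighborhood G x) > 0"
      using insert.prems(2)[rule_format, OF insertI1]
        spin_mult_imbalance_recolor_ge[of g col "neighborhood G x" X]
      unfolding c_def by linarith
    then have "switchable Majority G c x"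
      using False cx by (simp add: switchable_Majority_iff[OF G] neq_color_iff)
    moreover have "recolor (insert x X) g col = c(x := opposite (c x))"
      using False insert.hyps by (auto simp: c_def recolor_def fun_eq_iff neq_color_iff)
    ultimately have "switching_step Majority G c (recolor (insert x X) g col)"
      using insert.prems(1) unfolding switching_step_def by auto
    moreover have "{v \<in> insert x X. col v \<noteq> g} = insert x {v \<in> X. col v \<noteq> g}"
      using False by auto
    ultimately show ?thesis
      using IH insert.hyps by (auto intro: relcomppI)
  qed
qed

lemma recolor_reachable:
  assumes "pair_graph G" "finite X" "X \<subseteq> pverts G"
    and "\<forall>v\<in>X. spin g * imbalance col (neighborhood G v) > 0"
  shows "(switching_step Majority G)\<^sup>*\<^sup>* col (recolor X g col)"
  using recolor_run[OF assms] by (rule relpowp_imp_rtranclp)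

section \<open>Termination of the majority process\<close>

definition agreement :: "'a sgraph \<Rightarrow> ('a \<Rightarrow> color) \<Rightarrow> int" where
  "agreement G col = (\<Sum>(u, w) \<in> parcs G. spin (col u) * spin (col w))"

text \<open>Only the arcs at the switched node change their contribution, and each of them changes
  its sign. Every edge is counted by both of its arcs, so the gain is -4 times the product in
  \<open>switchable_Majority_iff\<close>, which is negative.\<close>

lemma agreement_less_step:
  assumes G: "pair_graph G" and step: "switching_step Majority G col col'"
  shows "agreement G col < agreement G col'"
proof -
  interpret pair_graph G by fact
  obtain v where v: "switchable Majority G col v" and col': "col' = col(v := opposite (col v))"
    using step unfolding switching_step_def by blast
  let ?N = "neighborhood G v"
  let ?out = "{v} \<times> ?N" and ?in = "?N \<times> {v}"
  have vN: "v \<notin> ?N" using pair_no_loops by (fastforce simp: neighborhood_def)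
  have fN: "finite ?N" by (rule finite_neighborhood[OF G])
  have sym: "(u, v) \<in> parcs G \<longleftrightarrow> (v, u) \<in> parcs G" for u
    using pair_sym_arcs arcs_symmetric by blast
  define d where
    "d = (\<lambda>(u, w). spin (col' u) * spin (col' w) - spin (col u) * spin (col w))"
  have sub: "?out \<union> ?in \<subseteq> parcs G"
    using sym by (auto simp: neighborhood_def)
  have zero: "d e = 0" if "e \<in> parcs G - (?out \<union> ?in)" for e
  proof -
    obtain u w where e: "e = (u, w)" by (cases e)
    have "u \<noteq> v" "w \<noteq> v" using that sym[of u] by (auto simp: e neighborhood_def)
    then show ?thesis by (simp add: e d_def col')
  qed
  have "agreement G col' - agreement G col = (\<Sum>e\<in>parcs G. d e)"
    unfolding agreement_def d_def by (simp add: sum_subtractf case_prod_unfold)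
  also have "\<dots> = (\<Sum>e\<in>?out \<union> ?in. d e)"
    using zero sub by (intro sum.mono_neutral_right) auto
  also have "\<dots> = (\<Sum>e\<in>?out. d e) + (\<Sum>e\<in>?in. d e)"
    using fN vN by (intro sum.union_disjoint) auto
  also have "(\<Sum>e\<in>?out. d e) = (\<Sum>u\<in>?N. - 2 * spin (col v) * spin (col u))"
    using vN by (intro sum.reindex_bij_witness[of _ "\<lambda>u. (v, u)" snd])
      (auto simp: d_def col')
  also have "(\<Sum>e\<in>?in. d e) = (\<Sum>u\<in>?N. - 2 * spin (col v) * spin (col u))"
    using vN by (intro sum.reindex_bij_witness[of _ "\<lambda>u. (u, v)" fst])
      (auto simp: d_def col')
  also have "(\<Sum>u\<in>?N. - 2 * spin (col v) * spin (col u)) = -2 * (spin (col v) * imbalance col ?N)"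
    by (simp add: imbalance_def sum_distrib_left mult.assoc)
  finally show ?thesis
    using v unfolding switchable_Majority_iff[OF G] by linarith
qed

lemma agreement_le: "agreement G col \<le> int (card (parcs G))"
proof -
  have "agreement G col \<le> (\<Sum>e\<in>parcs G. 1)"
    unfolding agreement_def by (intro sum_mono) (auto simp: spin_mult_le_1)
  then show ?thesis by simp
qed

text \<open>The integer potential \<open>agreement\<close> grows strictly and is bounded by the
  number of arcs, so switching must stop. Since \<open>stabilization_time\<close> ranges over
  completed runs only, every partial run has to be continued to a stable coloring.\<close>

lemma ex_stable_reachable:
  assumes "pair_graph G"
  shows "\<exists>col'. (switching_step Majority G)\<^sup>*\<^sup>* col col' \<and> stable Majority G col'"
proof (induction "nat (int (card (parcs G)) - agreement G col)" arbitrary: col rule: less_induct)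
  case less
  show ?case
  proof (cases "stable Majority G col")
    case False
    then obtain col1 where step: "switching_step Majority G col col1"
      unfolding stable_def switching_step_def by blast
    have "nat (int (card (parcs G)) - agreement G col1) < nat (int (card (parcs G)) - agreement G col)"
      using agreement_less_step[OF assms step] agreement_le[of G col1] by linarith
    from less[OF this] show ?thesis
      using step by (meson converse_rtranclp_into_rtranclp)
  qed blast
qed

lemma stabilization_time_ge:
  assumes G: "pair_graph G" and reach: "(switching_step Majority G)\<^sup>*\<^sup>* col col1"
    and run: "(switching_step Majority G ^^ n) col1 col2" and "k \<le> n"
  shows "enat k \<le> stabilization_time Majority G col"
proof -
  obtain i where i: "(switching_step Majority G ^^ i) col col1"
    using reach rtranclp_imp_relpowp by fast
  obtain col3 j where "stable Majority G col3" "(switching_step Majority G ^^ j) col2 col3"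
    using ex_stable_reachable[OF G, of col2] rtranclp_imp_relpowp by fast
  then have "(switching_step Majority G ^^ (i + n + j)) col col3" "stable Majority G col3"
    using i run unfolding relpowp_add by (auto intro: relcomppI)
  then have "enat (i + n + j) \<le> stabilization_time Majority G col"
    unfolding stabilization_time_def by (intro Sup_upper) blast
  moreover have "enat k \<le> enat (i + n + j)" using \<open>k \<le> n\<close> by simp
  ultimately show ?thesis by (rule order_trans[rotated])
qed

section \<open>Reduction of the minority process on bipartite graphs\<close>

definition flip_on :: "'a set \<Rightarrow> ('a \<Rightarrow> color) \<Rightarrow> 'a \<Rightarrow> color" where
  "flip_on S col = (\<lambda>v. if v \<in> S then opposite (col v) else col v)"

lemma flip_on_flip_on [simp]: "flip_on S (flip_on S col) = col"
  by (simp add: flip_on_def fun_eq_iff)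

text \<open>Every edge has exactly one end in \<open>S\<close>, so flipping \<open>S\<close>
  exchanges equal and different colors along each edge.\<close>

lemma switchable_Minority_iff:
  assumes "\<forall>(u, v)\<in>parcs G. u \<in> S \<longleftrightarrow> v \<notin> S"
  shows "switchable Minority G col v \<longleftrightarrow> switchable Majority G (flip_on S col) v"
proof -
  have "conflicting Minority (col v) (col u) \<longleftrightarrow>
        conflicting Majority (flip_on S col v) (flip_on S col u)" if "(v, u) \<in> parcs G" for u
    using assms that by (cases "col u"; cases "col v") (auto simp: flip_on_def)
  then have "conflicting_neighbors Minority G col v =
      conflicting_neighbors Majority G (flip_on S col) v"
    unfolding conflicting_neighbors_def neighborhood_def by blast
  then show ?thesis by (simp add: switchable_def)
qed

lemma switching_step_Minority_iff:
  assumes "\<forall>(u, v)\<in>parcs G. u \<in> S \<longleftrightarrow> v \<notin> S"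
  shows "switching_step Minority G col col' \<longleftrightarrow>
         switching_step Majority G (flip_on S col) (flip_on S col')"
proof -
  have "flip_on S (col(v := opposite (col v))) = (flip_on S col)(v := opposite (flip_on S col v))" for v
    by (auto simp: flip_on_def fun_eq_iff)
  then have "col' = col(v := opposite (col v)) \<longleftrightarrow>
      flip_on S col' = (flip_on S col)(v := opposite (flip_on S col v))" for v
    by (metis flip_on_flip_on)
  then show ?thesis
    unfolding switching_step_def switchable_Minority_iff[OF assms] by simp
qed

text \<open>The involution \<open>flip_on S\<close> carries the steps and the stable colorings of
  one process to those of the other, so completed runs correspond with equal length.\<close>

lemma stabilization_time_Minority:
  assumes "\<forall>(u, v)\<in>parcs G. u \<in> S \<longleftrightarrow> v \<notin> S"
  shows "stabilization_time Minority G col = stabilization_time Majority G (flip_on S col)"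
proof -
  have run: "(switching_step Minority G ^^ k) c c' \<longleftrightarrow>
      (switching_step Majority G ^^ k) (flip_on S c) (flip_on S c')" for k c c'
  proof (induction k arbitrary: c')
    case 0
    then show ?case by (metis flip_on_flip_on relpowp_0_E relpowp_0_I)
  next
    case (Suc k)
    have "(switching_step Minority G ^^ Suc k) c c' \<longleftrightarrow>
        (\<exists>d. (switching_step Majority G ^^ k) (flip_on S c) (flip_on S d) \<and>
             switching_step Majority G (flip_on S d) (flip_on S c'))"
      unfolding relpowp.simps relcompp_apply Suc.IH switching_step_Minority_iff[OF assms] ..
    \<comment> \<open>Every coloring is of the form \<open>flip_on S d\<close>, so the quantifier
      may range over that image directly.\<close>
    also have "\<dots> \<longleftrightarrow> (\<exists>d. (switching_step Majority G ^^ k) (flip_on S c) d \<and>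
             switching_step Majority G d (flip_on S c'))"
      by (metis flip_on_flip_on)
    finally show ?case unfolding relpowp.simps relcompp_apply .
  qed
  have st: "stable Minority G c \<longleftrightarrow> stable Majority G (flip_on S c)" for c
    unfolding stable_def switchable_Minority_iff[OF assms] ..
  have "(\<exists>c'. (switching_step Minority G ^^ k) col c' \<and> stable Minority G c') \<longleftrightarrow>
     (\<exists>c'. (switching_step Majority G ^^ k) (flip_on S col) c' \<and> stable Majority G c')" for k
    unfolding run st by (metis flip_on_flip_on)
  then show ?thesis unfolding stabilization_time_def by simp
qed

section \<open>The blow-up graph\<close>

datatype cell = Work | Ctrl color | Out color nat | Mid color nat | Inn color nat

instance cell :: countable
  by countable_datatype

text \<open>\<open>Mid g j\<close> outweighs the typical imbalance of \<open>Ctrl g\<close> at the nodes of \<open>Out g j\<close>, and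
  \<open>Inn g j\<close> outweighs \<open>Out g j\<close> at the nodes of \<open>Mid g j\<close>. The extra node of \<open>Ctrl White\<close> makes
  the degree of the nodes of \<open>Work\<close> odd.\<close>

fun width :: "nat \<Rightarrow> cell \<Rightarrow> nat" where
  "width q Work = q ^ 3"
| "width q (Ctrl g) = 4 * q ^ 3 + of_bool (g = White)"
| "width q (Out g j) = q\<^sup>2"
| "width q (Mid g j) = 2 * q\<^sup>2 + 1"
| "width q (Inn g j) = q\<^sup>2 + 1"

definition cells :: "nat \<Rightarrow> cell set" where
  "cells q = {Work} \<union> range Ctrl \<union> (\<Union>g. \<Union>j<8 * q. {Out g j, Mid g j, Inn g j})"

fun adjacent_cells :: "nat \<Rightarrow> cell \<Rightarrow> cell set" where
  "adjacent_cells q Work = range Ctrl"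
| "adjacent_cells q (Ctrl g) = insert Work (Out g ` {..<8 * q})"
| "adjacent_cells q (Out g j) = {Ctrl g, Mid g j}"
| "adjacent_cells q (Mid g j) = {Out g j, Inn g j}"
| "adjacent_cells q (Inn g j) = {Mid g j}"

text \<open>Encoding the pairs by the injective \<open>to_nat\<close> keeps the blocks of different
  cells disjoint and puts all graphs of the class over one node type.\<close>

definition block :: "nat \<Rightarrow> cell \<Rightarrow> nat set" where
  "block q c = (\<lambda>i. to_nat (c, i)) ` {..<width q c}"

definition blowup :: "nat \<Rightarrow> nat sgraph" where
  "blowup q = \<lparr>pverts = (\<Union>c\<in>cells q. block q c),
     parcs = (\<Union>c\<in>cells q. \<Union>d\<in>adjacent_cells q c. block q c \<times> block q d)\<rparr>"

lemma finite_block [simp]: "finite (block q c)"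
  by (simp add: block_def)

lemma card_block [simp]: "card (block q c) = width q c"
  by (simp add: block_def card_image inj_on_def)

lemma block_disjoint: "c \<noteq> d \<Longrightarrow> block q c \<inter> block q d = {}"
  by (auto simp: block_def)

lemma block_unique: "v \<in> block q c \<Longrightarrow> v \<in> block q d \<Longrightarrow> c = d"
  using block_disjoint by blast

lemma cells_simps [simp]:
  "Work \<in> cells q" "Ctrl g \<in> cells q" "Out g j \<in> cells q \<longleftrightarrow> j < 8 * q"
  "Mid g j \<in> cells q \<longleftrightarrow> j < 8 * q" "Inn g j \<in> cells q \<longleftrightarrow> j < 8 * q"
  by (auto simp: cells_def)

lemma finite_cells: "finite (cells q)"
  by (simp add: cells_def)

lemma finite_adjacent_cells: "finite (adjacent_cells q c)"
  by (cases c) auto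

lemma adjacent_cells_sym:
  "c \<in> cells q \<Longrightarrow> d \<in> adjacent_cells q c \<Longrightarrow> d \<in> cells q \<and> c \<in> adjacent_cells q d \<and> c \<noteq> d"
  by (cases c) auto

lemma parcs_blowup_iff:
  "(u, v) \<in> parcs (blowup q) \<longleftrightarrow>
     (\<exists>c\<in>cells q. \<exists>d\<in>adjacent_cells q c. u \<in> block q c \<and> v \<in> block q d)"
  by (auto simp: blowup_def)

lemma pair_graph_blowup: "pair_graph (blowup q)"
proof
  show "finite (pverts (blowup q))"
    by (simp add: blowup_def finite_cells)
  have "finite (parcs (blowup q))"
    by (simp add: blowup_def finite_cells finite_adjacent_cells)
  then show "finite (parcs (blowup q))" .
next
  fix e assume e: "e \<in> parcs (blowup q)"
  then obtain c d where cd: "c \<in> cells q" "d \<in> adjacent_cells q c"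
    "fst e \<in> block q c" "snd e \<in> block q d"
    by (auto simp: blowup_def)
  show "fst e \<in> pverts (blowup q)" "snd e \<in> pverts (blowup q)"
    using cd adjacent_cells_sym[OF cd(1,2)] by (auto simp: blowup_def)
  show "fst e \<noteq> snd e"
    using cd adjacent_cells_sym[OF cd(1,2)] block_unique by metis
next
  have "sym (parcs (blowup q))"
  proof (rule symI)
    fix u v assume "(u, v) \<in> parcs (blowup q)"
    then obtain c d where cd: "c \<in> cells q" "d \<in> adjacent_cells q c" "u \<in> block q c" "v \<in> block q d"
      by (auto simp: blowup_def)
    then show "(v, u) \<in> parcs (blowup q)"
      using adjacent_cells_sym[OF cd(1,2)] by (auto simp: blowup_def)
  qed
  then show "symmetric (blowup q)"
    by (simp add: symmetric_def)
qed

lemma block_subset_pverts: "c \<in> cells q \<Longrightarrow> block q c \<subseteq> pverts (blowup q)"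
  by (auto simp: blowup_def)

lemma neighborhood_blowup:
  assumes "c \<in> cells q" "v \<in> block q c"
  shows "neighborhood (blowup q) v = (\<Union>d\<in>adjacent_cells q c. block q d)"
proof -
  have "(v, u) \<in> parcs (blowup q) \<longleftrightarrow> (\<exists>d\<in>adjacent_cells q c. u \<in> block q d)" for u
    unfolding parcs_blowup_iff using assms block_unique[of v q c] by blast
  then show ?thesis by (auto simp: neighborhood_def)
qed

text \<open>All nodes of a block have the same neighborhood, a disjoint union of blocks. Whether a
  block can be recolored is thereby a question about sums of block imbalances.\<close>

lemma imbalance_neighborhood:
  assumes "c \<in> cells q" "v \<in> block q c"
  shows "imbalance col (neighborhood (blowup q) v) = (\<Sum>d\<in>adjacent_cells q c. imbalance col (block q d))"
  unfolding neighborhood_blowup[OF assms] imbalance_def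
  by (rule sum.UNION_disjoint) (auto simp: finite_adjacent_cells block_disjoint)

section \<open>Bipartition and number of nodes\<close>

fun even_cell :: "cell \<Rightarrow> bool" where
  "even_cell (Ctrl g) \<longleftrightarrow> True"
| "even_cell (Mid g j) \<longleftrightarrow> True"
| "even_cell _ \<longleftrightarrow> False"

definition even_side :: "nat \<Rightarrow> nat set" where
  "even_side q = (\<Union>c \<in> {c \<in> cells q. even_cell c}. block q c)"

lemma bipartite_blowup:
  "\<forall>(u, v) \<in> parcs (blowup q). u \<in> even_side q \<longleftrightarrow> v \<notin> even_side q"
proof -
  have *: "v \<in> even_side q \<longleftrightarrow> even_cell c" if "c \<in> cells q" "v \<in> block q c" for v c
    unfolding even_side_def using that block_unique by blast
  have "u \<in> even_side q \<longleftrightarrow> v \<notin> even_side q" if uv: "(u, v) \<in> parcs (blowup q)" for u v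
  proof -
    obtain c d where cd: "c \<in> cells q" "d \<in> adjacent_cells q c" "u \<in> block q c" "v \<in> block q d"
      using uv unfolding parcs_blowup_iff by blast
    have "even_cell c \<longleftrightarrow> \<not> even_cell d"
      using cd(2) by (cases c) auto
    then show ?thesis
      using *[of c u] *[of d v] cd adjacent_cells_sym[OF cd(1,2)] by simp
  qed
  then show ?thesis by blast
qed

lemma even_side_subset: "even_side q \<subseteq> pverts (blowup q)"
  by (auto simp: even_side_def blowup_def)

lemma num_nodes_blowup: "num_nodes (blowup q) = 73 * q ^ 3 + 32 * q + 1"
proof -
  let ?T = "\<lambda>g. Out g ` {..<8 * q} \<union> (Mid g ` {..<8 * q} \<union> Inn g ` {..<8 * q})"
  have "num_nodes (blowup q) = (\<Sum>c\<in>cells q. width q c)"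
    unfolding num_nodes_def blowup_def
    using card_UN_disjoint[OF finite_cells, of q "block q"] by (simp add: block_disjoint)
  also have "cells q = insert Work (insert (Ctrl Black) (insert (Ctrl White) (?T Black \<union> ?T White)))"
    by (auto simp: cells_def UNIV_color)
  \<comment> \<open>Each of the \<open>8 * q\<close> chains per color has
    \<open>q^2 + (2 * q^2 + 1) + (q^2 + 1) = 4 * q^2 + 2\<close> nodes.\<close>
  also have "(\<Sum>c\<in>\<dots>. width q c) = q ^ 3 + (8 * q ^ 3 + 1) + 2 * (8 * q * (4 * q\<^sup>2 + 2))"
  proof -
    have T: "(\<Sum>c\<in>?T g. width q c) = 8 * q * (4 * q\<^sup>2 + 2)" for g
      by (subst sum.union_disjoint; force?)+ (simp add: sum.reindex inj_on_def algebra_simps)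
    have "(\<Sum>c\<in>?T Black \<union> ?T White. width q c) = 2 * (8 * q * (4 * q\<^sup>2 + 2))"
      by (subst sum.union_disjoint) (auto simp: T simp del: width.simps)
    then show ?thesis
      by (subst sum.insert; force?)+
  qed
  finally show ?thesis by (simp add: algebra_simps power2_eq_square power3_eq_cube)
qed

section \<open>A long run from a typical coloring\<close>

definition recolor_cells :: "nat \<Rightarrow> cell set \<Rightarrow> color \<Rightarrow> (nat \<Rightarrow> color) \<Rightarrow> nat \<Rightarrow> color" where
  "recolor_cells q D g col = recolor (\<Union>c\<in>D. block q c) g col"

lemma imbalance_recolor_cells [simp]:
  "imbalance (recolor_cells q D g col) (block q c) =
     (if c \<in> D then spin g * int (width q c) else imbalance col (block q c))"
proof (cases "c \<in> D")
  case True
  then show ?thesis unfolding recolor_cells_def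
    by (subst imbalance_recolor_superset) auto
next
  case False
  then have "(\<Union>c\<in>D. block q c) \<inter> block q c = {}"
    using block_unique by blast
  then show ?thesis using False unfolding recolor_cells_def
    by (simp add: imbalance_recolor_disjoint)
qed

section \<open>Driving the chains to their color\<close>

lemma recolor_cells_reachable:
  assumes "D \<subseteq> cells q"
    and "\<forall>c\<in>D. spin g * (\<Sum>d\<in>adjacent_cells q c. imbalance col (block q d)) > 0"
  shows "(switching_step Majority (blowup q))\<^sup>*\<^sup>* col (recolor_cells q D g col)"
  unfolding recolor_cells_def
proof (rule recolor_reachable[OF pair_graph_blowup])
  show "finite (\<Union>c\<in>D. block q c)"
    using finite_subset[OF assms(1) finite_cells] by auto
  show "(\<Union>c\<in>D. block q c) \<subseteq> pverts (blowup q)"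
    using assms(1) block_subset_pverts by blast
  show "\<forall>v\<in>\<Union>c\<in>D. block q c. spin g * imbalance col (neighborhood (blowup q) v) > 0"
    using assms imbalance_neighborhood by (metis UN_E subsetD)
qed

text \<open>The two ways to start a chain: if \<open>Mid g j\<close> leans to \<open>g\<close>, then
  \<open>Inn g j\<close>, which sees nothing else, can follow it first; otherwise
  \<open>Out g j\<close> and \<open>Inn g j\<close>, the whole neighborhood of
  \<open>Mid g j\<close>, must already favor \<open>g\<close>.\<close>

definition settable :: "nat \<Rightarrow> color \<Rightarrow> (nat \<Rightarrow> color) \<Rightarrow> nat \<Rightarrow> bool" where
  "settable q g col j \<longleftrightarrow> spin g * imbalance col (block q (Mid g j)) > 0 \<or>
     spin g * (imbalance col (block q (Out g j)) + imbalance col (block q (Inn g j))) > 0"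

text \<open>Three rounds recolor \<open>Inn\<close>, then \<open>Mid\<close>, then
  \<open>Out\<close>; the first round is restricted to chains whose \<open>Mid\<close> leans to
  \<open>g\<close>. The last conclusion lets the lemma be applied to both colors in turn, as the
  chains of the other color and the \<open>Ctrl\<close> blocks stay intact.\<close>

lemma settle:
  assumes "q \<ge> 1" and C: "\<bar>imbalance col (block q (Ctrl g))\<bar> \<le> 2 * int (q\<^sup>2)"
    and U: "card {j. j < 8 * q \<and> \<not> settable q g col j} \<le> 3 * q"
  shows "\<exists>col'. (switching_step Majority (blowup q))\<^sup>*\<^sup>* col col' \<and>
    spin g * (\<Sum>j<8 * q. imbalance col' (block q (Out g j))) > int (q ^ 3) \<and>
    (\<forall>c. c \<notin> range (Out g) \<union> range (Mid g) \<union> range (Inn g) \<longrightarrow>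
      imbalance col' (block q c) = imbalance col (block q c))"
proof -
  define J1 where "J1 = {j. j < 8 * q \<and> spin g * imbalance col (block q (Mid g j)) > 0}"
  define J where "J = {j. j < 8 * q \<and> settable q g col j}"
  define col1 where "col1 = recolor_cells q (Inn g ` J1) g col"
  define col2 where "col2 = recolor_cells q (Mid g ` J) g col1"
  define col3 where "col3 = recolor_cells q (Out g ` J) g col2"
  let ?R = "(switching_step Majority (blowup q))\<^sup>*\<^sup>*"
  have "J1 \<subseteq> J" by (auto simp: J1_def J_def settable_def)
  have "?R col col1"
    unfolding col1_def by (rule recolor_cells_reachable) (auto simp: J1_def)
  also have "?R col1 col2"
    unfolding col2_def
  proof (rule recolor_cells_reachable)
    have "spin g * (imbalance col1 (block q (Out g j)) + imbalance col1 (block q (Inn g j))) > 0"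
      if j: "j \<in> J" for j
    proof (cases "j \<in> J1")
      case True
      \<comment> \<open>The \<open>q^2 + 1\<close> nodes of \<open>Inn g j\<close> now all have
        color \<open>g\<close> and outvote any coloring of the \<open>q^2\<close> nodes of
        \<open>Out g j\<close>.\<close>
      have "\<bar>spin g * imbalance col (block q (Out g j))\<bar> \<le> int (q\<^sup>2)"
        using abs_imbalance_le[of col "block q (Out g j)"] by (simp add: abs_mult)
      then show ?thesis
        using True by (auto simp: col1_def image_iff algebra_simps simp flip: mult.assoc)
    next
      case False
      then show ?thesis
        using j by (auto simp: col1_def image_iff J1_def J_def settable_def)
    qed
    then show "\<forall>c\<in>Mid g ` J. spin g * (\<Sum>d\<in>adjacent_cells q c. imbalance col1 (block q d)) > 0"
      by auto
  qed (auto simp: J_def)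
  also have "?R col2 col3"
    unfolding col3_def
  proof (rule recolor_cells_reachable)
    \<comment> \<open>This is where the bound on \<open>Ctrl g\<close> enters: the
      \<open>2 * q^2 + 1\<close> nodes of \<open>Mid g j\<close>, all of color \<open>g\<close>,
      exceed it by one.\<close>
    have "\<bar>spin g * imbalance col (block q (Ctrl g))\<bar> \<le> 2 * int (q\<^sup>2)"
      using C by (simp add: abs_mult)
    then have "spin g * (imbalance col2 (block q (Ctrl g)) + imbalance col2 (block q (Mid g j))) > 0"
      if "j \<in> J" for j
      using that by (auto simp: col2_def col1_def image_iff algebra_simps simp flip: mult.assoc)
    then show "\<forall>c\<in>Out g ` J. spin g * (\<Sum>d\<in>adjacent_cells q c. imbalance col2 (block q d)) > 0"
      by auto
  qed (auto simp: J_def)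
  finally have reach: "?R col col3" .
  let ?U = "{j. j < 8 * q \<and> \<not> settable q g col j}"
  \<comment> \<open>A driven chain contributes \<open>q^2\<close>, any other chain at worst
    \<open>-q^2\<close>. With at most \<open>3 * q\<close> bad chains the sum is at least
    \<open>(8 * q - 2 * 3 * q) * q^2 = 2 * q^3\<close>.\<close>
  have "int (q\<^sup>2) - 2 * int (q\<^sup>2) * of_bool (j \<in> ?U) \<le> spin g * imbalance col3 (block q (Out g j))"
    if "j < 8 * q" for j
  proof (cases "j \<in> J")
    case True
    then show ?thesis
      by (auto simp: col3_def image_iff simp flip: mult.assoc)
  next
    case False
    have "\<bar>spin g * imbalance col3 (block q (Out g j))\<bar> \<le> int (q\<^sup>2)"
      using abs_imbalance_le[of col3 "block q (Out g j)"] by (simp add: abs_mult)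
    then show ?thesis using False that by (auto simp: J_def)
  qed
  then have "(\<Sum>j<8 * q. int (q\<^sup>2) - 2 * int (q\<^sup>2) * of_bool (j \<in> ?U)) \<le>
      (\<Sum>j<8 * q. spin g * imbalance col3 (block q (Out g j)))"
    by (intro sum_mono) simp
  also have "(\<Sum>j<8 * q. int (q\<^sup>2) - 2 * int (q\<^sup>2) * of_bool (j \<in> ?U)) =
      int (q\<^sup>2) * (8 * int q) - 2 * int (q\<^sup>2) * (\<Sum>j<8 * q. of_bool (j \<in> ?U))"
    by (simp add: sum_subtractf flip: sum_distrib_left)
  also have "(\<Sum>j<8 * q. of_bool (j \<in> ?U)) = int (card ?U)"
  proof -
    have "{..<8 * q} \<inter> ?U = ?U" by auto
    then show ?thesis by (simp add: sum.If_cases of_bool_def Int_def)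
  qed
  finally have "int (q\<^sup>2) * (8 * int q) - 2 * int (q\<^sup>2) * int (card ?U) \<le>
      (\<Sum>j<8 * q. spin g * imbalance col3 (block q (Out g j)))" .
  moreover have "2 * int (q\<^sup>2) * int (card ?U) \<le> 2 * int (q\<^sup>2) * int (3 * q)"
    using U by (intro mult_left_mono) auto
  moreover have "int (q\<^sup>2) * (8 * int q) - 2 * int (q\<^sup>2) * int (3 * q) = 2 * int (q ^ 3)"
    by (simp add: power2_eq_square power3_eq_cube)
  ultimately have "2 * int (q ^ 3) \<le> (\<Sum>j<8 * q. spin g * imbalance col3 (block q (Out g j)))"
    by linarith
  moreover have "int (q ^ 3) > 0" using \<open>q \<ge> 1\<close> by simp
  ultimately have "int (q ^ 3) < spin g * (\<Sum>j<8 * q. imbalance col3 (block q (Out g j)))"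
    unfolding sum_distrib_left by linarith
  moreover have "imbalance col3 (block q c) = imbalance col (block q c)"
    if "c \<notin> range (Out g) \<union> range (Mid g) \<union> range (Inn g)" for c
    using that by (auto simp: col3_def col2_def col1_def)
  ultimately show ?thesis using reach by blast
qed

section \<open>Control nodes, workers and the alternating run\<close>

definition ready :: "nat \<Rightarrow> (nat \<Rightarrow> color) \<Rightarrow> bool" where
  "ready q col \<longleftrightarrow> (\<forall>g. spin g * (\<Sum>j<8 * q. imbalance col (block q (Out g j))) > int (q ^ 3))"

text \<open>The imbalance in the neighborhood of every node of \<open>Work\<close>; its sign is the
  color that the workers can take.\<close>

definition pull :: "nat \<Rightarrow> (nat \<Rightarrow> color) \<Rightarrow> int" where
  "pull q col = imbalance col (block q (Ctrl Black)) + imbalance col (block q (Ctrl White))"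

text \<open>The control nodes that can still be spent on moving \<open>pull\<close> towards
  \<open>g\<close>. Each is spent once, so their number limits the number of rounds.\<close>

definition reserve :: "nat \<Rightarrow> color \<Rightarrow> (nat \<Rightarrow> color) \<Rightarrow> nat set" where
  "reserve q g col = {v \<in> block q (Ctrl g). col v \<noteq> g}"

lemma finite_reserve [simp]: "finite (reserve q g col)"
  by (simp add: reserve_def)

text \<open>A node of \<open>Ctrl g\<close> sees \<open>Work\<close> and all \<open>Out g j\<close>.
  By \<open>ready\<close> the latter favor \<open>g\<close> by more than \<open>q^3\<close>, the
  size of \<open>Work\<close>, so the colors of the workers cannot prevent the switch. Neither set
  is changed by it, so \<open>ready\<close> persists.\<close>

lemma recolor_Ctrl:
  assumes ready: "ready q col" and X: "X \<subseteq> reserve q g col"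
  defines "col' \<equiv> recolor X g col"
  shows "(switching_step Majority (blowup q))\<^sup>*\<^sup>* col col'"
    and "ready q col'"
    and "pull q col' = pull q col + 2 * spin g * int (card X)"
    and "card (reserve q h col') = card (reserve q h col) - (if h = g then card X else 0)"
    and "\<forall>v\<in>block q Work. col' v = col v"
proof -
  have Xb: "X \<subseteq> block q (Ctrl g)" and Xg: "v \<in> X \<Longrightarrow> col v \<noteq> g" for v
    using X by (auto simp: reserve_def)
  have fX: "finite X" using X finite_subset finite_reserve by blast
  have dis: "X \<inter> block q c = {}" if "c \<noteq> Ctrl g" for c
    using Xb block_disjoint[OF that] by blast
  have oth: "imbalance col' (block q c) = imbalance col (block q c)" if "c \<noteq> Ctrl g" for c
    using dis[OF that] unfolding col'_def by (rule imbalance_recolor_disjoint)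
  show "(switching_step Majority (blowup q))\<^sup>*\<^sup>* col col'"
    unfolding col'_def
  proof (rule recolor_reachable[OF pair_graph_blowup fX])
    show "X \<subseteq> pverts (blowup q)"
      using Xb block_subset_pverts[of "Ctrl g" q] by auto
    show "\<forall>v\<in>X. spin g * imbalance col (neighborhood (blowup q) v) > 0"
    proof
      fix v assume "v \<in> X"
      then have v: "v \<in> block q (Ctrl g)" using Xb by blast
      have "imbalance col (neighborhood (blowup q) v) =
          imbalance col (block q Work) + (\<Sum>j<8 * q. imbalance col (block q (Out g j)))"
        by (subst imbalance_neighborhood[OF _ v])
          (simp, simp, subst sum.insert, auto simp: sum.reindex inj_on_def)
      moreover have "\<bar>spin g * imbalance col (block q Work)\<bar> \<le> int (q ^ 3)"
        using abs_imbalance_le[of col "block q Work"] by (simp add: abs_mult)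
      moreover have "spin g * (\<Sum>j<8 * q. imbalance col (block q (Out g j))) > int (q ^ 3)"
        using ready unfolding ready_def by blast
      ultimately show "spin g * imbalance col (neighborhood (blowup q) v) > 0"
        by (simp only: distrib_left)
    qed
  qed
  show "ready q col'"
    using ready by (simp add: ready_def oth)
  have "imbalance col' (block q (Ctrl g)) = imbalance col (block q (Ctrl g)) + 2 * spin g * int (card X)"
    unfolding col'_def using Xb Xg by (intro imbalance_recolor_subset) auto
  then show "pull q col' = pull q col + 2 * spin g * int (card X)"
    unfolding pull_def by (cases g) (auto simp: oth)
  have "reserve q h col' = (if h = g then reserve q h col - X else reserve q h col)"
    using dis[of "Ctrl h"] by (auto simp: reserve_def col'_def recolor_def)
  then show "card (reserve q h col') = card (reserve q h col) - (if h = g then card X else 0)"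
    using X fX by (auto simp: card_Diff_subset)
  show "\<forall>v\<in>block q Work. col' v = col v"
    using dis[of Work] by (auto simp: col'_def recolor_def)
qed

lemma recolor_Work:
  assumes "spin g * pull q col > 0"
  defines "col' \<equiv> recolor (block q Work) g col"
  shows "(switching_step Majority (blowup q) ^^ card {v \<in> block q Work. col v \<noteq> g}) col col'"
    and "ready q col' = ready q col"
    and "pull q col' = pull q col"
    and "reserve q h col' = reserve q h col"
    and "\<forall>v\<in>block q Work. col' v = g"
proof -
  have dis: "block q Work \<inter> block q c = {}" if "c \<noteq> Work" for c
    using block_disjoint[of Work c] that by blast
  have oth: "imbalance col' (block q c) = imbalance col (block q c)" if "c \<noteq> Work" for c
    using dis[OF that] unfolding col'_def by (rule imbalance_recolor_disjoint)
  have "imbalance col (neighborhood (blowup q) v) = pull q col" if "v \<in> block q Work" for v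
    by (subst imbalance_neighborhood[OF _ that]) (auto simp: UNIV_color pull_def)
  then show "(switching_step Majority (blowup q) ^^ card {v \<in> block q Work. col v \<noteq> g}) col col'"
    unfolding col'_def using assms block_subset_pverts[of Work q]
    by (intro recolor_run[OF pair_graph_blowup]) auto
  show "ready q col' = ready q col" "pull q col' = pull q col"
    by (simp_all add: ready_def pull_def oth)
  show "reserve q h col' = reserve q h col"
    using dis[of "Ctrl h"] by (auto simp: reserve_def col'_def recolor_def)
  show "\<forall>v\<in>block q Work. col' v = g"
    by (simp add: col'_def recolor_def)
qed

text \<open>One round spends one reserve node of each color: \<open>pull\<close> goes from -1 to 1,
  the workers turn black, \<open>pull\<close> returns to -1, the workers turn white.\<close>

lemma long_run:
  assumes "ready q col" "pull q col = -1" "\<And>g. card (reserve q g col) \<ge> r"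
  shows "\<exists>n \<ge> r * q ^ 3. \<exists>col'. (switching_step Majority (blowup q) ^^ n) col col'"
  using assms
proof (induction r arbitrary: col)
  case 0
  show ?case by (intro exI[of _ 0] conjI exI[of _ col]) auto
next
  case (Suc r)
  let ?S = "switching_step Majority (blowup q)"
  obtain x where x: "x \<in> reserve q Black col"
    using Suc.prems(3)[of Black] by fastforce
  define col1 where "col1 = recolor {x} Black col"
  note c1 = recolor_Ctrl[OF Suc.prems(1), of "{x}" Black, folded col1_def]
  have p1: "pull q col1 = 1" using c1(3) x Suc.prems(2) by simp
  define col2 where "col2 = recolor (block q Work) Black col1"
  note c2 = recolor_Work[of Black q col1, folded col2_def]
  have p2: "pull q col2 = 1" using c2(3) p1 by simp
  have r2: "ready q col2" using c1(2) c2(2) p1 x by simp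
  have "card (reserve q White col2) \<ge> Suc r"
    using Suc.prems(3)[of White] c1(4)[of White] c2(4) p1 x by simp
  then obtain y where y: "y \<in> reserve q White col2" by fastforce
  define col3 where "col3 = recolor {y} White col2"
  note c3 = recolor_Ctrl[OF r2, of "{y}" White, folded col3_def]
  have p3: "pull q col3 = -1" using c3(3) y p2 by simp
  define col4 where "col4 = recolor (block q Work) White col3"
  note c4 = recolor_Work[of White q col3, folded col4_def]
  have p4: "pull q col4 = -1" using c4(3) p3 by simp
  have r4: "ready q col4" using c3(2) c4(2) p3 y by simp
  have "card (reserve q g col4) \<ge> r" for g
    using Suc.prems(3)[of g] c1(4)[of g] c2(4)[of g] c3(4)[of g] c4(4)[of g] p1 p3 x y
    by (simp split: if_splits)
  from Suc.IH[OF r4 p4 this] obtain n col5 where n: "n \<ge> r * q ^ 3" "(?S ^^ n) col4 col5"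
    by blast
  have "?S\<^sup>*\<^sup>* col col3"
    using c1(1) c2(1) c3(1) x y p1 by (auto dest: relpowp_imp_rtranclp)
  then obtain i where i: "(?S ^^ i) col col3" using rtranclp_imp_relpowp by fast
  \<comment> \<open>Only the second sweep is counted: before the first one the colors of the workers
    are unknown, but now all \<open>q^3\<close> of them are black and will switch.\<close>
  have "\<forall>v\<in>block q Work. col3 v = Black"
    using c3(5) c2(5) y p1 by simp
  then have "{v \<in> block q Work. col3 v \<noteq> White} = block q Work" by auto
  then have "(?S ^^ (q ^ 3)) col3 col4" using c4(1) p3 by simp
  then have "(?S ^^ (i + q ^ 3 + n)) col col5"
    using i n(2) unfolding relpowp_add by (auto intro: relcomppI)
  then show ?case using n(1) by (intro exI[of _ "i + q ^ 3 + n"] conjI exI[of _ col5]) auto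
qed

text \<open>Each control node spent moves \<open>pull\<close> by 2, so an odd value of size at most
  \<open>4 * q^2\<close> can be brought to -1 by spending nodes of a single color.\<close>

lemma align:
  assumes ready: "ready q col" and odd: "odd (pull q col)" and small: "\<bar>pull q col\<bar> \<le> 4 * int (q\<^sup>2)"
    and res: "\<And>g. card (reserve q g col) \<ge> r + 2 * q\<^sup>2 + 1"
  shows "\<exists>col'. (switching_step Majority (blowup q))\<^sup>*\<^sup>* col col' \<and> ready q col' \<and>
    pull q col' = -1 \<and> (\<forall>g. card (reserve q g col') \<ge> r)"
proof -
  obtain t where t: "pull q col = 2 * t + 1" using odd by (rule oddE)
  \<comment> \<open>For \<open>pull = 2 * t + 1\<close> the witness is \<open>-1 - t\<close> nodes
    turned black if \<open>t\<close> is negative, and \<open>t + 1\<close> nodes turned white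
    otherwise.\<close>
  obtain g and k :: nat where gk: "pull q col + 2 * spin g * int k = -1" "k \<le> 2 * q\<^sup>2 + 1"
  proof (cases "t < 0")
    case True
    then show ?thesis
      using that[of Black "nat (- 1 - t)"] small by (simp add: t nat_le_iff)
  next
    case False
    then show ?thesis
      using that[of White "nat (t + 1)"] small by (simp add: t nat_le_iff)
  qed
  then have "k \<le> card (reserve q g col)" using res[of g] by linarith
  then obtain X where X: "X \<subseteq> reserve q g col" "card X = k"
    using obtain_subset_with_card_n by metis
  note t = recolor_Ctrl[OF ready X(1)]
  have "card (reserve q h (recolor X g col)) \<ge> r" for h
    using t(4)[of h] res[of h] gk(2) X(2) by (auto split: if_splits)
  then show ?thesis using t(1-3) gk X by (intro exI[of _ "recolor X g col"]) auto
qed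

text \<open>The deterministic part: the black chains are settled, then the white ones,
  \<open>pull\<close> is aligned to -1, and \<open>q^3\<close> rounds with at least
  \<open>q^3\<close> steps each follow.\<close>

lemma stabilization_time_blowup_ge:
  assumes q: "q \<ge> 4"
    and C: "\<And>g. \<bar>imbalance col (block q (Ctrl g))\<bar> \<le> 2 * int (q\<^sup>2)"
    and U: "\<And>g. card {j. j < 8 * q \<and> \<not> settable q g col j} \<le> 3 * q"
  shows "enat (q ^ 6) \<le> stabilization_time Majority (blowup q) col"
proof -
  let ?R = "(switching_step Majority (blowup q))\<^sup>*\<^sup>*"
  from settle[OF _ C[of Black] U[of Black]] q obtain col1 where c1: "?R col col1"
    "int (q ^ 3) < spin Black * (\<Sum>j<8 * q. imbalance col1 (block q (Out Black j)))"
    "\<And>c. c \<notin> range (Out Black) \<union> range (Mid Black) \<union> range (Inn Black) \<Longrightarrow>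
      imbalance col1 (block q c) = imbalance col (block q c)"
    by auto
  \<comment> \<open>Settling the black chains leaves the white ones as they were, so the hypotheses
    of \<open>settle\<close> carry over.\<close>
  have s1: "settable q White col1 j = settable q White col j" for j
    unfolding settable_def by (subst (1 2 3) c1(3)) auto
  have C1: "imbalance col1 (block q (Ctrl g)) = imbalance col (block q (Ctrl g))" for g
    by (rule c1(3)) auto
  obtain col2 where c2: "?R col1 col2"
    "int (q ^ 3) < spin White * (\<Sum>j<8 * q. imbalance col2 (block q (Out White j)))"
    "\<And>c. c \<notin> range (Out White) \<union> range (Mid White) \<union> range (Inn White) \<Longrightarrow>
      imbalance col2 (block q c) = imbalance col1 (block q c)"
    using settle[of q col1 White] q C[of White] U[of White] by (auto simp: s1 C1)
  have C2: "imbalance col2 (block q (Ctrl g)) = imbalance col (block q (Ctrl g))" for g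
    using C1 by (subst c2(3)) auto
  have "imbalance col2 (block q (Out Black j)) = imbalance col1 (block q (Out Black j))" for j
    by (rule c2(3)) auto
  then have "spin g * (\<Sum>j<8 * q. imbalance col2 (block q (Out g j))) > int (q ^ 3)" for g
    using c1(2) c2(2) by (cases g) simp_all
  then have ready: "ready q col2"
    unfolding ready_def by blast
  have eq: "spin g * imbalance col (block q (Ctrl g)) =
      int (width q (Ctrl g)) - 2 * int (card (reserve q g col2))" for g
    using imbalance_eq_card[of "block q (Ctrl g)" g col2] by (simp add: C2 reserve_def)
  \<comment> \<open>The sizes \<open>4 * q^3\<close> and \<open>4 * q^3 + 1\<close> of the two
    \<open>Ctrl\<close> blocks differ in parity.\<close>
  have odd: "odd (pull q col2)"
  proof -
    have "pull q col2 = spin Black * imbalance col (block q (Ctrl Black)) -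
        spin White * imbalance col (block q (Ctrl White))"
      by (simp add: pull_def C2)
    then show ?thesis unfolding eq by simp
  qed
  have small: "\<bar>pull q col2\<bar> \<le> 4 * int (q\<^sup>2)"
    using C[of Black] C[of White] unfolding pull_def C2 by linarith
  \<comment> \<open>The imbalance bound leaves at least \<open>2 * q^3 - q^2\<close> nodes in
    reserve. This covers the \<open>q^3\<close> rounds and the alignment once
    \<open>3 * q^2 + 1 \<le> q^3\<close>, which holds from \<open>q = 4\<close> on.\<close>
  have res: "card (reserve q g col2) \<ge> q ^ 3 + 2 * q\<^sup>2 + 1" for g
  proof -
    have "spin g * imbalance col (block q (Ctrl g)) \<le> 2 * int (q\<^sup>2)"
      using C[of g] by (cases g) auto
    then have "int (4 * q ^ 3) \<le> 2 * int (q\<^sup>2) + 2 * int (card (reserve q g col2))"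
      unfolding eq by (cases g) simp_all
    moreover have "3 * q\<^sup>2 + 1 \<le> q ^ 3"
    proof -
      have "4 * q\<^sup>2 \<le> q * q\<^sup>2" using q by (intro mult_right_mono) auto
      moreover have "1 \<le> q\<^sup>2" using q by simp
      moreover have "q * q\<^sup>2 = q ^ 3" by (simp add: power3_eq_cube power2_eq_square)
      ultimately show ?thesis by linarith
    qed
    ultimately show ?thesis by linarith
  qed
  obtain col3 where c3: "?R col2 col3" "ready q col3" "pull q col3 = -1"
    "\<forall>g. card (reserve q g col3) \<ge> q ^ 3"
    using align[OF ready odd small res] by blast
  obtain n col4 where n: "n \<ge> q ^ 3 * q ^ 3" "(switching_step Majority (blowup q) ^^ n) col3 col4"
    using long_run[OF c3(2,3) c3(4)[rule_format]] by blast
  have "?R col col3"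
    using c1(1) c2(1) c3(1) by (meson rtranclp_trans)
  moreover have "q ^ 6 \<le> n"
    using n(1) by (simp flip: power_add)
  ultimately show ?thesis
    using n(2) by (intro stabilization_time_ge[OF pair_graph_blowup])
qed

section \<open>Random colorings\<close>

abbreviation coin_flips :: "'a set \<Rightarrow> ('a \<Rightarrow> color) pmf" where
  "coin_flips V \<equiv> Pi_pmf V White (\<lambda>_. pmf_of_set {White, Black})"

text \<open>The distribution is uniform on the colorings that are \<open>White\<close> outside
  \<open>V\<close>. As \<open>S\<close> lies in \<open>V\<close>, flipping respects this default and
  permutes these colorings.\<close>

lemma map_flip_on_coin_flips:
  assumes "finite V" "S \<subseteq> V"
  shows "map_pmf (flip_on S) (coin_flips V) = coin_flips V"
proof -
  let ?E = "PiE_dflt V White (\<lambda>_. {White, Black})"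
  have flip: "flip_on S f \<in> ?E" if "f \<in> ?E" for f
    using that assms(2) unfolding UNIV_color[symmetric] by (auto simp: PiE_dflt_def flip_on_def)
  have "bij_betw (flip_on S) ?E ?E"
    by (rule bij_betwI[of _ _ _ "flip_on S"]) (auto simp: flip)
  moreover have "finite ?E" using assms(1) by auto
  moreover have "?E \<noteq> {}" by auto
  ultimately show ?thesis
    using assms(1) by (simp add: Pi_pmf_of_set map_pmf_of_set_bij_betw)
qed

lemma expectation_flip_on:
  fixes f :: "('a \<Rightarrow> color) \<Rightarrow> real"
  assumes "finite V" "S \<subseteq> V"
  shows "measure_pmf.expectation (coin_flips V) (\<lambda>col. f (flip_on S col)) =
         measure_pmf.expectation (coin_flips V) f"
  using integral_map_pmf[of "flip_on S" "coin_flips V" f] by (simp add: map_flip_on_coin_flips[OF assms])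

text \<open>By the flip symmetry the expectation equals its own negative.\<close>

lemma expectation_eq_0_if_odd:
  fixes f :: "('a \<Rightarrow> color) \<Rightarrow> real"
  assumes "finite V" "S \<subseteq> V" "\<And>col. f (flip_on S col) = - f col"
  shows "measure_pmf.expectation (coin_flips V) f = 0"
  using expectation_flip_on[OF assms(1,2), of f] by (simp add: assms(3))

lemma integrable_coin_flips [simp]:
  fixes f :: "('a \<Rightarrow> color) \<Rightarrow> real"
  assumes "finite V"
  shows "integrable (measure_pmf (coin_flips V)) f"
  using assms by (intro integrable_measure_pmf_finite) (simp add: set_Pi_pmf finite_PiE_dflt)

text \<open>Restrictions of a random function to disjoint sets of coordinates are independent, and
  by locality \<open>F j\<close> factors through the restriction to \<open>K j\<close>. Finiteness
  of \<open>K j\<close> and of the codomain makes the product space discrete, so measurability is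
  automatic.\<close>

lemma indep_vars_Pi_pmf_blocks:
  fixes F :: "'i \<Rightarrow> ('a \<Rightarrow> 'b :: finite) \<Rightarrow> real"
  assumes "finite V" and K: "\<And>j. j \<in> L \<Longrightarrow> K j \<subseteq> V" "disjoint_family_on K L"
    and local: "\<And>j f g. j \<in> L \<Longrightarrow> (\<forall>v\<in>K j. f v = g v) \<Longrightarrow> F j f = F j g"
  shows "prob_space.indep_vars (measure_pmf (Pi_pmf V d p)) (\<lambda>_. borel) F L"
proof -
  have "prob_space.indep_vars (measure_pmf (Pi_pmf V d p))
      (\<lambda>j. PiM (K j) (\<lambda>_. count_space UNIV)) (\<lambda>j f. restrict (\<lambda>v. f v) (K j)) L"
    by (rule prob_space.indep_vars_restrict[OF prob_space_measure_pmf indep_vars_Pi_pmf[OF assms(1)]])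
      (use K in auto)
  moreover have "F j \<in> PiM (K j) (\<lambda>_. count_space UNIV) \<rightarrow>\<^sub>M borel" if "j \<in> L" for j
  proof -
    have "finite (K j)" using K(1)[OF that] assms(1) finite_subset by blast
    then have "PiM (K j) (\<lambda>_. count_space (UNIV :: 'b set)) = count_space (K j \<rightarrow>\<^sub>E UNIV)"
      by (rule count_space_PiM_finite) auto
    then show ?thesis by simp
  qed
  ultimately have "prob_space.indep_vars (measure_pmf (Pi_pmf V d p)) (\<lambda>_. borel)
      (\<lambda>j f. F j (restrict (\<lambda>v. f v) (K j))) L"
    by (rule prob_space.indep_vars_compose2[OF prob_space_measure_pmf])
  then show ?thesis
    by (subst prob_space.indep_vars_cong[OF prob_space_measure_pmf refl _ refl]) (auto simp: fun_eq_iff intro!: local)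
qed

lemma prob_imbalance_large:
  assumes V: "finite V" and "X \<subseteq> V" "X \<noteq> {}" "t \<ge> 0"
  shows "measure_pmf.prob (coin_flips V) {col. \<bar>real_of_int (imbalance col X)\<bar> \<ge> t} \<le>
         2 * exp (- (t\<^sup>2 / (2 * real (card X))))"
proof -
  have X: "finite X" using assms finite_subset by blast
  let ?F = "\<lambda>v col. real_of_int (spin (col v))"
  have E0: "measure_pmf.expectation (coin_flips V) (?F v) = 0" if "v \<in> X" for v
    using assms(2) that by (intro expectation_eq_0_if_odd[OF V, of "{v}"]) (auto simp: flip_on_def)
  interpret H: Hoeffding_ineq "measure_pmf (coin_flips V)" X ?F "\<lambda>_. -1" "\<lambda>_. 1" 0
  proof unfold_locales
    show "prob_space.indep_vars (measure_pmf (coin_flips V)) (\<lambda>_. borel) ?F X"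
      using assms by (intro indep_vars_Pi_pmf_blocks[where K = "\<lambda>v. {v}"])
        (auto simp: disjoint_family_on_def)
    show "AE col in measure_pmf (coin_flips V). ?F v col \<in> {-1..1}" for v
    proof (rule AE_I2)
      show "?F v col \<in> {-1..1}" for col by (cases "col v") auto
    qed
    show "0 \<equiv> \<Sum>v\<in>X. measure_pmf.expectation (coin_flips V) (?F v)"
      using E0 by (intro eq_reflection) simp
  qed (fact X)
  have "card X > 0" using X \<open>X \<noteq> {}\<close> by (simp add: card_gt_0_iff)
  \<comment> \<open>Each spin lies in an interval of length 2, so the squared lengths in Hoeffding's
    inequality add up to \<open>4 * card X\<close>.\<close>
  then have "measure_pmf.prob (coin_flips V) {col. \<bar>\<Sum>v\<in>X. ?F v col\<bar> \<ge> t} \<le>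
      2 * exp (- 2 * t\<^sup>2 / (4 * real (card X)))"
    using H.Hoeffding_ineq_abs_ge[OF \<open>t \<ge> 0\<close>] by (simp add: mult.commute)
  then show ?thesis by (simp add: imbalance_def field_simps)
qed

lemma imbalance_flip_on_subset: "X \<subseteq> S \<Longrightarrow> imbalance (flip_on S col) X = - imbalance col X"
  unfolding imbalance_def sum_negf[symmetric]
  by (intro sum.cong) (auto simp: flip_on_def)

lemma imbalance_flip_on_disjoint: "X \<inter> S = {} \<Longrightarrow> imbalance (flip_on S col) X = imbalance col X"
  by (intro imbalance_cong) (auto simp: flip_on_def)

lemma odd_imbalance: "finite X \<Longrightarrow> odd (card X) \<Longrightarrow> odd (imbalance col X)"
  using imbalance_eq_card[of X Black col] by simp

text \<open>No independence is needed to compute \<open>1/4\<close> as the mean of the failure indicator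
  \<open>(1 - s\<^sub>M) (1 - s\<^sub>N) / 4\<close>: each of \<open>s\<^sub>M\<close>, \<open>s\<^sub>N\<close> and \<open>s\<^sub>M s\<^sub>N\<close> changes its sign when the
  colors on one of the two sets are flipped.\<close>

lemma prob_many_unsettable:
  assumes "q \<ge> 1"
  shows "measure_pmf.prob (random_coloring (blowup q))
    {col. card {j. j < 8 * q \<and> \<not> settable q g col j} > 3 * q} \<le> exp (- (real q / 4))"
proof -
  define V where "V = pverts (blowup q)"
  define M where "M = (\<lambda>j. block q (Mid g j))"
  define N where "N = (\<lambda>j. block q (Out g j) \<union> block q (Inn g j))"
  define s where "s = (\<lambda>(X :: nat set) col. real_of_int (sgn (spin g * imbalance col X)))"
  define F where "F = (\<lambda>j col. (1 - s (M j) col) * (1 - s (N j) col) / 4)"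
  let ?P = "coin_flips V"
  have P: "random_coloring (blowup q) = ?P" by (simp add: random_coloring_def V_def)
  have V: "finite V" using finite_cells by (simp add: V_def blowup_def)
  have sub: "M j \<subseteq> V" "N j \<subseteq> V" if "j < 8 * q" for j
    using that block_subset_pverts[of "Mid g j" q] block_subset_pverts[of "Out g j" q]
      block_subset_pverts[of "Inn g j" q] by (auto simp: M_def N_def V_def)
  have dis: "M j \<inter> N j = {}" for j
    using block_disjoint[of "Mid g j" "Out g j" q] block_disjoint[of "Mid g j" "Inn g j" q]
    by (auto simp: M_def N_def)
  have odd: "odd (spin g * imbalance col (M j))" "odd (spin g * imbalance col (N j))" for col j
    using odd_imbalance[of "M j" col] odd_imbalance[of "N j" col]
    by (cases g; simp add: M_def N_def card_Un_disjoint block_disjoint)+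
  have sum_N: "imbalance col (N j) = imbalance col (block q (Out g j)) + imbalance col (block q (Inn g j))"
    for col j unfolding N_def by (simp add: imbalance_Un block_disjoint)
  have flip_same: "s X (flip_on X col) = - s X col" for X col
    by (simp add: s_def imbalance_flip_on_subset sgn_minus)
  have flip_other: "s X (flip_on Y col) = s X col" if "X \<inter> Y = {}" for X Y col
    using that by (simp add: s_def imbalance_flip_on_disjoint)
  have EF: "measure_pmf.expectation ?P (F j) = 1 / 4" if j: "j < 8 * q" for j
  proof -
    have "measure_pmf.expectation ?P (s (M j)) = 0"
      by (rule expectation_eq_0_if_odd[OF V sub(1)[OF j]]) (rule flip_same)
    moreover have "measure_pmf.expectation ?P (s (N j)) = 0"
      by (rule expectation_eq_0_if_odd[OF V sub(2)[OF j]]) (rule flip_same)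
    moreover have "measure_pmf.expectation ?P (\<lambda>col. s (M j) col * s (N j) col) = 0"
      using dis[of j] by (intro expectation_eq_0_if_odd[OF V sub(1)[OF j]])
        (simp add: flip_same flip_other Int_commute)
    moreover have "F j = (\<lambda>col. (1 - s (M j) col - s (N j) col + s (M j) col * s (N j) col) / 4)"
      by (auto simp: F_def fun_eq_iff algebra_simps)
    ultimately show ?thesis by (simp add: V)
  qed
  have s_values: "s X col \<in> {-1, 0, 1}" for X col
    by (simp add: s_def sgn_if)
  have F01: "F j col \<in> {0..1}" for j col
    using s_values[of "M j" col] s_values[of "N j" col] by (auto simp: F_def)
  \<comment> \<open>The mean is \<open>8 * q / 4 = 2 * q\<close>, so having more than
    \<open>3 * q\<close> unsettable chains is a deviation of at least \<open>q\<close>.\<close>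
  interpret H: Hoeffding_ineq "measure_pmf ?P" "{..<8 * q}" F "\<lambda>_. 0" "\<lambda>_. 1" "2 * real q"
  proof unfold_locales
    show "prob_space.indep_vars (measure_pmf ?P) (\<lambda>_. borel) F {..<8 * q}"
    proof (rule indep_vars_Pi_pmf_blocks[OF V, where K = "\<lambda>j. M j \<union> N j"])
      show "disjoint_family_on (\<lambda>j. M j \<union> N j) {..<8 * q}"
        unfolding disjoint_family_on_def M_def N_def using block_unique by blast
      fix j and f h :: "nat \<Rightarrow> color" assume "\<forall>v\<in>M j \<union> N j. f v = h v"
      then have "imbalance f (M j) = imbalance h (M j)" "imbalance f (N j) = imbalance h (N j)"
        by (auto intro!: imbalance_cong)
      then show "F j f = F j h" by (simp add: F_def s_def)
    qed (use sub in auto)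
    show "AE col in measure_pmf ?P. F j col \<in> {0..1}" for j
      by (rule AE_I2) (rule F01)
    show "2 * real q \<equiv> \<Sum>j<8 * q. measure_pmf.expectation ?P (F j)"
      by (intro eq_reflection) (simp add: EF)
  qed auto
  \<comment> \<open>Oddness excludes the sign 0, so on failure both signs are -1 and
    \<open>F j\<close> is \<open>2 * 2 / 4\<close>.\<close>
  have F1: "F j col = 1" if "\<not> settable q g col j" for j col
  proof -
    have "\<not> 0 < spin g * imbalance col (M j)" "\<not> 0 < spin g * imbalance col (N j)"
      using that by (auto simp: settable_def M_def sum_N)
    moreover have "spin g * imbalance col (M j) \<noteq> 0" "spin g * imbalance col (N j) \<noteq> 0"
      using odd[of col j] even_zero by metis+
    ultimately have "spin g * imbalance col (M j) < 0" "spin g * imbalance col (N j) < 0"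
      by linarith+
    then show ?thesis by (simp add: F_def s_def)
  qed
  have "{col. card {j. j < 8 * q \<and> \<not> settable q g col j} > 3 * q} \<subseteq>
      {col. (\<Sum>j<8 * q. F j col) \<ge> 2 * real q + real q}"
  proof safe
    fix col assume *: "card {j. j < 8 * q \<and> \<not> settable q g col j} > 3 * q"
    let ?U = "{j. j < 8 * q \<and> \<not> settable q g col j}"
    have "real (card ?U) = (\<Sum>j\<in>?U. F j col)" by (simp add: F1)
    also have "\<dots> \<le> (\<Sum>j<8 * q. F j col)" using F01 by (intro sum_mono2) auto
    finally show "(\<Sum>j<8 * q. F j col) \<ge> 2 * real q + real q" using * by linarith
  qed
  then have "measure_pmf.prob ?P {col. card {j. j < 8 * q \<and> \<not> settable q g col j} > 3 * q} \<le>
      measure_pmf.prob ?P {col. (\<Sum>j<8 * q. F j col) \<ge> 2 * real q + real q}"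
    by (intro measure_pmf.finite_measure_mono) auto
  also have "\<dots> \<le> exp (- 2 * (real q)\<^sup>2 / (8 * real q))"
    using H.Hoeffding_ineq_ge[of "real q"] assms by simp
  also have "- 2 * (real q)\<^sup>2 / (8 * real q) = - (real q / 4)"
    using assms by (simp add: field_simps power2_eq_square)
  finally show ?thesis unfolding P .
qed

text \<open>Weakens the exponential tail bounds to polynomial ones, the form in which
  \<open>whp\<close> measures failure.\<close>

lemma exp_minus_le_inverse:
  fixes x :: real
  assumes "x > 0"
  shows "exp (- x) \<le> 1 / x"
proof -
  have "x \<le> exp x" using exp_ge_add_one_self[of x] by linarith
  then show ?thesis using assms by (simp add: exp_minus field_simps)
qed

text \<open>The block has order \<open>q^3\<close> nodes, hence a typical imbalance of order
  \<open>q powr (3/2)\<close>. The threshold \<open>2 * q^2\<close> exceeds this by a factor of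
  order \<open>sqrt q\<close>, which makes the tail exponentially small in \<open>q\<close>.\<close>

lemma prob_Ctrl_imbalance:
  assumes "q \<ge> 1"
  shows "measure_pmf.prob (random_coloring (blowup q))
    {col. \<bar>imbalance col (block q (Ctrl g))\<bar> > 2 * int (q\<^sup>2)} \<le> 5 / real q"
proof -
  let ?V = "pverts (blowup q)" and ?X = "block q (Ctrl g)"
  have "measure_pmf.prob (coin_flips ?V) {col. \<bar>imbalance col ?X\<bar> > 2 * int (q\<^sup>2)} \<le>
      measure_pmf.prob (coin_flips ?V) {col. \<bar>real_of_int (imbalance col ?X)\<bar> \<ge> 2 * (real q)\<^sup>2}"
  proof (rule measure_pmf.finite_measure_mono)
    show "{col. \<bar>imbalance col ?X\<bar> > 2 * int (q\<^sup>2)} \<subseteq>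
        {col. \<bar>real_of_int (imbalance col ?X)\<bar> \<ge> 2 * (real q)\<^sup>2}"
    proof safe
      fix col assume "\<bar>imbalance col ?X\<bar> > 2 * int (q\<^sup>2)"
      then have "real_of_int (2 * int (q\<^sup>2)) \<le> real_of_int \<bar>imbalance col ?X\<bar>"
        by (simp only: of_int_le_iff)
      then show "\<bar>real_of_int (imbalance col ?X)\<bar> \<ge> 2 * (real q)\<^sup>2" by simp
    qed
  qed simp
  also have "\<dots> \<le> 2 * exp (- ((2 * (real q)\<^sup>2)\<^sup>2 / (2 * real (card ?X))))"
  proof (rule prob_imbalance_large)
    show "finite ?V" using finite_cells by (simp add: blowup_def)
    have "card ?X \<noteq> 0" using assms by simp
    then show "?X \<noteq> {}" by (metis card.empty)
    show "?X \<subseteq> ?V" by (rule block_subset_pverts) simp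
  qed simp
  also have "\<dots> \<le> 2 * exp (- (2 / 5 * real q))"
  proof -
    \<comment> \<open>With this bound the exponent is at least
      \<open>4 * q^4 / (10 * q^3) = 2 / 5 * q\<close>.\<close>
    have "card ?X \<le> 5 * q ^ 3"
      using assms one_le_power[of q 3] by (auto simp: of_bool_def)
    then have "real (card ?X) \<le> 5 * real q ^ 3"
      by (metis of_nat_le_iff of_nat_mult of_nat_numeral of_nat_power)
    then have "4 * real q * real (card ?X) \<le> 4 * real q * (5 * real q ^ 3)"
      by (intro mult_left_mono) auto
    moreover have "real (card ?X) > 0"
      unfolding of_nat_0_less_iff using assms by simp
    ultimately have "2 / 5 * real q \<le> (2 * (real q)\<^sup>2)\<^sup>2 / (2 * real (card ?X))"
      by (simp add: field_simps power2_eq_square power3_eq_cube del: card_block)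
    then show ?thesis by simp
  qed
  also have "\<dots> \<le> 5 / real q"
    using exp_minus_le_inverse[of "2 / 5 * real q"] assms by simp
  finally show ?thesis by (simp add: random_coloring_def)
qed

lemma prob_stabilization_time_Majority:
  assumes "q \<ge> 4"
  shows "measure_pmf.prob (random_coloring (blowup q))
    {col. enat (q ^ 6) \<le> stabilization_time Majority (blowup q) col} \<ge> 1 - 18 / real q"
proof -
  let ?P = "measure_pmf.prob (random_coloring (blowup q))"
  let ?A = "{col. enat (q ^ 6) \<le> stabilization_time Majority (blowup q) col}"
  let ?B = "\<lambda>g. {col. \<bar>imbalance col (block q (Ctrl g))\<bar> > 2 * int (q\<^sup>2)}"
  let ?C = "\<lambda>g. {col. card {j. j < 8 * q \<and> \<not> settable q g col j} > 3 * q}"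
  have "- ?A \<subseteq> (\<Union>g. ?B g \<union> ?C g)"
    using stabilization_time_blowup_ge[OF assms] by (fastforce simp: not_less)
  then have "?P (- ?A) \<le> ?P (\<Union>g\<in>UNIV. ?B g \<union> ?C g)"
    by (intro measure_pmf.finite_measure_mono) auto
  also have "\<dots> \<le> (\<Sum>g\<in>UNIV. ?P (?B g \<union> ?C g))"
    by (intro measure_pmf.finite_measure_subadditive_finite) auto
  \<comment> \<open>Per color, \<open>5 / q\<close> accounts for the imbalance of
    \<open>Ctrl g\<close> and \<open>4 / q\<close> for too many unsettable chains.\<close>
  also have "\<dots> \<le> (\<Sum>g\<in>(UNIV :: color set). 9 / real q)"
  proof (rule sum_mono)
    fix g
    have "?P (?B g \<union> ?C g) \<le> ?P (?B g) + ?P (?C g)"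
      by (intro measure_Un_le) auto
    also have "\<dots> \<le> 5 / real q + exp (- (real q / 4))"
      using assms by (intro add_mono prob_Ctrl_imbalance prob_many_unsettable) auto
    also have "\<dots> \<le> 9 / real q"
      using exp_minus_le_inverse[of "real q / 4"] assms by (simp add: field_simps)
    finally show "?P (?B g \<union> ?C g) \<le> 9 / real q" .
  qed
  also have "\<dots> = 18 / real q"
    unfolding UNIV_color by simp
  finally show ?thesis
    using measure_pmf.prob_compl[of ?A "random_coloring (blowup q)"]
    by (simp add: Compl_eq_Diff_UNIV)
qed

text \<open>For \<open>Minority\<close> the event is the preimage of the majority event under
  flipping one side of the bipartition, and this flip preserves the distribution.\<close>

lemma prob_stabilization_time_blowup:
  assumes "q \<ge> 4"
  shows "measure_pmf.prob (random_coloring (blowup q))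
    {col. enat (q ^ 6) \<le> stabilization_time p (blowup q) col} \<ge> 1 - 18 / real q"
proof (cases p)
  case Majority
  then show ?thesis using prob_stabilization_time_Majority[OF assms] by simp
next
  case Minority
  let ?A = "\<lambda>p. {col. enat (q ^ 6) \<le> stabilization_time p (blowup q) col}"
  have "finite (pverts (blowup q))" using finite_cells by (simp add: blowup_def)
  from map_flip_on_coin_flips[OF this even_side_subset]
  have "measure_pmf.prob (random_coloring (blowup q)) (?A Majority) =
      measure_pmf.prob (map_pmf (flip_on (even_side q)) (random_coloring (blowup q))) (?A Majority)"
    by (simp add: random_coloring_def)
  also have "\<dots> = measure_pmf.prob (random_coloring (blowup q)) (?A Minority)"
    by (simp add: vimage_def stabilization_time_Minority[OF bipartite_blowup])
  finally show ?thesis using Minority prob_stabilization_time_Majority[OF assms] by simp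
qed

theorem theorem4:
  fixes p :: process
  shows "\<exists>\<G> :: nat sgraph set.
           (\<forall>G \<in> \<G>. pair_graph G) \<and>
           (\<forall>N. \<exists>G \<in> \<G>. num_nodes G \<ge> N) \<and>
           (\<exists>\<alpha> > 0. whp \<G> (\<lambda>G col.
              ereal_of_enat (stabilization_time p G col) \<ge> ereal (\<alpha> * real (num_nodes G) ^ 2)))"
proof (intro exI[of _ "blowup ` {4..}"] conjI)
  show "\<forall>G \<in> blowup ` {4..}. pair_graph G"
    using pair_graph_blowup by blast
  show "\<forall>N. \<exists>G \<in> blowup ` {4..}. num_nodes G \<ge> N"
  proof
    fix N
    have "N \<le> num_nodes (blowup (N + 4))" unfolding num_nodes_blowup by simp
    then show "\<exists>G \<in> blowup ` {4..}. num_nodes G \<ge> N" by force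
  qed
  \<comment> \<open>The bound uses \<open>73 + 32 + 1 \<le> 125\<close>; the cube 125 has the exact
    root 5, and its square 15625 gives the constant of the lower bound.\<close>
  have n: "real (num_nodes (blowup q)) \<le> 125 * real q ^ 3" if "q \<ge> 4" for q
  proof -
    have "1 \<le> q\<^sup>2" using that by simp
    then have "q * 1 \<le> q * q\<^sup>2" by (rule mult_left_mono) simp
    moreover have "q * q\<^sup>2 = q ^ 3" by (simp add: power2_eq_square power3_eq_cube)
    ultimately have "num_nodes (blowup q) \<le> 125 * q ^ 3"
      using that unfolding num_nodes_blowup by linarith
    then show ?thesis by (metis of_nat_le_iff of_nat_mult of_nat_numeral of_nat_power)
  qed
  have time: "ereal (1 / 15625 * real (num_nodes (blowup q)) ^ 2) \<le>
      ereal_of_enat (stabilization_time p (blowup q) col)"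
    if "q \<ge> 4" and t: "enat (q ^ 6) \<le> stabilization_time p (blowup q) col" for q col
  proof -
    have "real (num_nodes (blowup q)) ^ 2 \<le> (125 * real q ^ 3) ^ 2"
      by (intro power_mono n \<open>q \<ge> 4\<close>) simp
    also have "\<dots> = 15625 * real q ^ 6"
      by (simp add: power_mult_distrib flip: power_mult)
    finally have "ereal (1 / 15625 * real (num_nodes (blowup q)) ^ 2) \<le> ereal (real (q ^ 6))"
      by simp
    also have "\<dots> = ereal_of_enat (enat (q ^ 6))"
      by simp
    also have "\<dots> \<le> ereal_of_enat (stabilization_time p (blowup q) col)"
      using t by (simp only: ereal_of_enat_le_iff)
    finally show ?thesis .
  qed
  \<comment> \<open>From \<open>n \<le> (5 * q)^3\<close> it follows that
    \<open>n powr (-1/3)\<close> is at least \<open>1 / (5 * q)\<close>, so 90 times it covers the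
    failure probability \<open>18 / q\<close>.\<close>
  have prob: "1 - 90 * real (num_nodes (blowup q)) powr (- (1 / 3)) \<le>
      measure_pmf.prob (random_coloring (blowup q)) {col.
        ereal (1 / 15625 * real (num_nodes (blowup q)) ^ 2) \<le>
        ereal_of_enat (stabilization_time p (blowup q) col)}" if "q \<ge> 4" for q
  proof -
    have "real (num_nodes (blowup q)) > 0"
      unfolding of_nat_0_less_iff num_nodes_blowup by simp
    then have "(125 * real q ^ 3) powr (- (1 / 3)) \<le> real (num_nodes (blowup q)) powr (- (1 / 3))"
      using n[OF that] by (intro powr_mono2') auto
    also have "(125 * real q ^ 3) = (5 * real q) powr 3"
      using that by (simp add: power_mult_distrib)
    also have "\<dots> powr (- (1 / 3)) = 1 / (5 * real q)"
      unfolding powr_powr using that by (simp add: powr_minus_divide)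
    finally have "1 - 90 * real (num_nodes (blowup q)) powr (- (1 / 3)) \<le> 1 - 18 / real q"
      by (simp add: field_simps)
    also have "\<dots> \<le> measure_pmf.prob (random_coloring (blowup q))
        {col. enat (q ^ 6) \<le> stabilization_time p (blowup q) col}"
      by (rule prob_stabilization_time_blowup[OF that])
    also have "\<dots> \<le> measure_pmf.prob (random_coloring (blowup q)) {col.
        ereal (1 / 15625 * real (num_nodes (blowup q)) ^ 2) \<le>
        ereal_of_enat (stabilization_time p (blowup q) col)}"
      using time[OF that] by (intro measure_pmf.finite_measure_mono) auto
    finally show ?thesis .
  qed
  show "\<exists>\<alpha> > 0. whp (blowup ` {4..}) (\<lambda>G col.
      ereal_of_enat (stabilization_time p G col) \<ge> ereal (\<alpha> * real (num_nodes G) ^ 2))"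
    unfolding whp_def
    by (rule exI[of _ "1 / 15625"], rule conjI, simp, rule exI[of _ "1 / 3"], rule conjI, simp,
        rule exI[of _ 90], rule exI[of _ 0]) (use prob in auto)
qed

end
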